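(* Let $(\mathfrak g,J_M)$ be an $8$-dimensional real nilpotent Lie algebra with a 1-abelian complex structure defined by a regular (invertible) non-Hermitian matrix $M\in M_3(\mathbb C)$. Then there exists a basis $\{\sigma^i\}_{i=1}^4$ of $\mathfrak g^{1,0}$ such that the complex structure equations are $d\sigma^1=d\sigma^2=d\sigma^3=0$ and one of the following: $J^4_{r1}$: $d\sigma^4=\sigma^{1\bar 3}+\sigma^{2\bar 2}+\sigma^{3\bar 1}+i(\sigma^{3\bar 2}+\sigma^{2\bar 3})$; $J^4_{r2}$: $d\sigma^4=\sigma^{1\bar 2}+\sigma^{2\bar 1}+i\sigma^{2\bar 2}\pm\sigma^{3\bar 3}$; $J^4_{r3}$: $d\sigma^4=\sigma^{1\bar 2}+\sigma^{2\bar 1}+i\sigma^{2\bar 2}+z\sigma^{3\bar 3}$, $|z|=1$, $z\neq\pm1$; $J^4_{r4+}$: $d\sigma^4=\sigma^{1\bar 1}+\sigma^{2\bar 2}+z\sigma^{3\bar 3}$, $|z|=1$, $z\neq\pm1$; $J^4_{r4-}$: $d\sigma^4=\sigma^{1\bar 1}-\sigma^{2\bar 2}+z\sigma^{3\bar 3}$, $|z|=1$, $z=e^{i\theta}$, $\theta\in(0,\pi)$; $J^4_{r5}$: $d\sigma^4=\sigma^{1\bar 2}+z_0\sigma^{2\bar 1}+\sigma^{3\bar 3}$, $|z_0|>1$; $J^4_{r6}$: $d\sigma^4=\sigma^{1\bar 1}+z\sigma^{2\bar 2}+z_1\sigma^{3\bar 3}$, $|z|=1$ and $z\neq\pm1$;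 $|z_1|=1$ and $z_1=e^{i\theta}$, $\theta\in(0,\pi)$; moreover $z\neq\pm z_1$.
   Context: For a complex structure $J$ on a real Lie algebra $\mathfrak g$, $\mathfrak g^{1,0}\subset\mathfrak g^*_{\mathbb C}$ is the space of $(1,0)$-forms and $d$ is the Chevalley–Eilenberg differential. We write $\sigma^{j\bar k}=\sigma^j\wedge\overline{\sigma^k}$. $J$ is abelian if $[Jx,Jy]=[x,y]$ for all $x,y$. An abelian complex structure on a $2n$-dimensional nilpotent Lie algebra is 1-abelian if $h^{1,0}=\dim H^{1,0}_{\bar\partial}(\mathfrak g)=\dim\ker(\bar\partial:\mathfrak g^{1,0}\to\bigwedge^{1,1}\mathfrak g^* )$ equals $n-1$. For every 1-abelian complex structure there are a basis $\{\omega^i\}_{i=1}^n$ of $\mathfrak g^{1,0}$ and a nonzero $M\in M_{n-1}(\mathbb C)$ with $d\omega^1=\dots=d\omega^{n-1}=0$ and $d\omega^n=\sum_{j,k=1}^{n-1}M_{jk}\,\omega^{j\bar k}$; the structure is then denoted $J_M$. A matrix $M$ is Hermitian if $M=\bar M^T$.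
   Formalization: "Non-Hermitian" is strengthened to: no nonzero complex multiple of M is Hermitian. As literally stated the claim fails, e.g. for M = iI, which rescaling of the last form turns into I, while no listed form is proportional to a Hermitian one. *)

theory Defs
  imports "HOL-Analysis.Analysis" "HOL-Library.Function_Algebras"
begin

text \<open>A finite-dimensional real Lie algebra is a real vector space type together with a bracket
  \<open>br\<close>.\<close>

definition lie_algebra :: "('g::real_vector \<Rightarrow> 'g \<Rightarrow> 'g) \<Rightarrow> bool" where
  "lie_algebra br \<longleftrightarrow>
     bilinear br \<and> (\<forall>x. br x x = 0) \<and>
     (\<forall>x y z. br x (br y z) + br y (br z x) + br z (br x y) = 0)"

primrec lower_central :: "('g::real_vector \<Rightarrow> 'g \<Rightarrow> 'g) \<Rightarrow> nat \<Rightarrow> 'g set" where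
  "lower_central br 0 = UNIV"
| "lower_central br (Suc k) = span {br x y | x y. y \<in> lower_central br k}"

definition nilpotent_lie :: "('g::real_vector \<Rightarrow> 'g \<Rightarrow> 'g) \<Rightarrow> bool" where
  "nilpotent_lie br \<longleftrightarrow> (\<exists>k. lower_central br k = {0})"

text \<open>The last conjunct is the vanishing of the Nijenhuis tensor.\<close>

definition complex_structure ::
  "('g::real_vector \<Rightarrow> 'g \<Rightarrow> 'g) \<Rightarrow> ('g \<Rightarrow> 'g) \<Rightarrow> bool" where
  "complex_structure br J \<longleftrightarrow>
     linear J \<and> (\<forall>x. J (J x) = - x) \<and>
     (\<forall>x y. br (J x) (J y) - br x y - J (br (J x) y) - J (br x (J y)) = 0)"

definition abelian_structure ::
  "('g::real_vector \<Rightarrow> 'g \<Rightarrow> 'g) \<Rightarrow> ('g \<Rightarrow> 'g) \<Rightarrow> bool" where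
  "abelian_structure br J \<longleftrightarrow>
     complex_structure br J \<and> (\<forall>x y. br (J x) (J y) = br x y)"

text \<open>The complexified dual is identified with the real-linear maps from the Lie algebra to the
  complex numbers; complex 2-forms are functions on pairs. Both are complex vector spaces under
  the pointwise operations.\<close>

definition cscale :: "complex \<Rightarrow> ('a \<Rightarrow> complex) \<Rightarrow> 'a \<Rightarrow> complex" (infixr "*\<^sub>F" 75) where
  "c *\<^sub>F f = (\<lambda>x. c * f x)"

global_interpretation cform: vector_space "cscale :: complex \<Rightarrow> ('a \<Rightarrow> complex) \<Rightarrow> 'a \<Rightarrow> complex"
  by unfold_locales (auto simp: cscale_def fun_eq_iff algebra_simps)

text \<open>A form \<open>\<alpha>\<close> is of type (1,0) iff it vanishes on all vectors \<open>x + \<i> J x\<close> of type (0,1).\<close>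

definition forms10 :: "('g::real_vector \<Rightarrow> 'g) \<Rightarrow> ('g \<Rightarrow> complex) set" where
  "forms10 J = {\<alpha>. linear \<alpha> \<and> (\<forall>x. \<alpha> (J x) = \<i> * \<alpha> x)}"

definition basis10 :: "('g::real_vector \<Rightarrow> 'g) \<Rightarrow> ('g \<Rightarrow> complex) list \<Rightarrow> bool" where
  "basis10 J \<sigma>s \<longleftrightarrow>
     distinct \<sigma>s \<and> cform.independent (set \<sigma>s) \<and> cform.span (set \<sigma>s) = forms10 J"

text \<open>The Chevalley--Eilenberg differential on 1-forms.\<close>

definition dCE :: "('g \<Rightarrow> 'g \<Rightarrow> 'g) \<Rightarrow> ('g \<Rightarrow> complex) \<Rightarrow> 'g \<times> 'g \<Rightarrow> complex" where
  "dCE br \<alpha> = (\<lambda>(x, y). - \<alpha> (br x y))"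

definition wedge :: "('g \<Rightarrow> complex) \<Rightarrow> ('g \<Rightarrow> complex) \<Rightarrow> 'g \<times> 'g \<Rightarrow> complex" where
  "wedge \<alpha> \<beta> = (\<lambda>(x, y). \<alpha> x * \<beta> y - \<alpha> y * \<beta> x)"

text \<open>\<open>wbar \<sigma>\<^sub>j \<sigma>\<^sub>k\<close> is the form written with upper indices j and k-bar.\<close>

definition wbar :: "('g \<Rightarrow> complex) \<Rightarrow> ('g \<Rightarrow> complex) \<Rightarrow> 'g \<times> 'g \<Rightarrow> complex" where
  "wbar \<alpha> \<beta> = wedge \<alpha> (\<lambda>x. cnj (\<beta> x))"

text \<open>The map \<open>\<beta> \<mapsto> \<beta> (J x, J y)\<close> acts as 1 on forms of type (1,1) and as -1 on
  forms of type (2,0) and (0,2), so averaging is the projection onto type (1,1).\<close>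

definition proj11 :: "('g \<Rightarrow> 'g) \<Rightarrow> ('g \<times> 'g \<Rightarrow> complex) \<Rightarrow> 'g \<times> 'g \<Rightarrow> complex" where
  "proj11 J \<beta> = (\<lambda>(x, y). (\<beta> (x, y) + \<beta> (J x, J y)) / 2)"

definition delbar ::
  "('g \<Rightarrow> 'g \<Rightarrow> 'g) \<Rightarrow> ('g \<Rightarrow> 'g) \<Rightarrow> ('g \<Rightarrow> complex) \<Rightarrow> 'g \<times> 'g \<Rightarrow> complex" where
  "delbar br J \<alpha> = proj11 J (dCE br \<alpha>)"

definition h10 :: "('g::real_vector \<Rightarrow> 'g \<Rightarrow> 'g) \<Rightarrow> ('g \<Rightarrow> 'g) \<Rightarrow> nat" where
  "h10 br J = cform.dim {\<alpha> \<in> forms10 J. delbar br J \<alpha> = 0}"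

text \<open>With \<open>dim UNIV = 2 * n\<close>, the equation says that \<open>h10 br J\<close> equals \<open>n - 1\<close>.\<close>

definition one_abelian ::
  "('g::real_vector \<Rightarrow> 'g \<Rightarrow> 'g) \<Rightarrow> ('g \<Rightarrow> 'g) \<Rightarrow> bool" where
  "one_abelian br J \<longleftrightarrow>
     abelian_structure br J \<and> dim (UNIV :: 'g set) = 2 * (h10 br J + 1)"

definition hermitian :: "complex^'n^'n \<Rightarrow> bool" where
  "hermitian M \<longleftrightarrow> M = map_matrix cnj (transpose M)"

end

theory Submission
  imports Defs "HOL-Computational_Algebra.Fundamental_Theorem_Algebra"
begin

text \<open>The matrix \<open>M\<close> is the Gram matrix of the sesquilinear form \<open>B(x, y) = x\<^sup>T M y\<^sup>*\<close>, where
the star denotes entrywise complex conjugation. A change of the closed forms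
\<open>\<omega>\<^sub>1, \<omega>\<^sub>2, \<omega>\<^sub>3\<close> by an invertible \<open>P\<close> together with a rescaling of the last form by \<open>c \<noteq> 0\<close> replaces \<open>M\<close> by \<open>c P\<^sup>T M P\<^sup>*\<close>
(lemma \<open>scaled_congruent_structure_equation\<close>). So the theorem is a classification of
nondegenerate sesquilinear forms on \<open>\<complex>\<^sup>3\<close> up to change of basis and scaling, in which the
forms proportional to a Hermitian one are set aside (\<open>invertible_classified\<close>).

The tool is the pencil of \<open>M\<close> and its conjugate transpose: a root \<open>l \<noteq> 0\<close> of
\<open>det (M - l M\<^sup>\<dagger>)\<close> gives a row vector \<open>v \<noteq> 0\<close> with \<open>B(v, y) = l (B(y, v))\<^sup>*\<close> for all \<open>y\<close>.
Its left and right orthogonal complements therefore coincide, and there are two cases.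

If \<open>B(v, v) \<noteq> 0\<close>, then \<open>\<complex>\<^sup>3\<close> is the orthogonal sum of the line of \<open>v\<close> and a plane, and the
argument is repeated on the plane (\<open>classified_block\<close>). When no eigenvector met in this way is
isotropic, \<open>B\<close> becomes diagonal. Each diagonal entry may be given modulus one; then only the lines
\<open>\<real> a\<close>, \<open>\<real> b\<close>, \<open>\<real> c\<close> of the entries and their relative signs matter, and these give
\<open>J\<^sub>r\<^sub>4\<close> when exactly two lines coincide and \<open>J\<^sub>r\<^sub>6\<close> when all differ,
while a single line means that the form is proportional to a Hermitian one (\<open>classified_diag3\<close>).

If \<open>B(v, v) = 0\<close>, the flag formed by the line of \<open>v\<close> and its complement gives a basis \<open>v, u, w\<close>
with \<open>B(v, w) = 1\<close>, \<open>B(w, v) = m \<noteq> 0\<close>, \<open>B(u, u) = 1\<close> and \<open>v\<close> orthogonal to \<open>v\<close> and \<open>u\<close>. Adding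
multiples of \<open>v\<close> to \<open>u\<close> and of \<open>u\<close> to \<open>w\<close>, one can make \<open>u\<close> orthogonal to \<open>w\<close>, unless \<open>m = 1\<close>
and a nontrivial obstruction remains, which is the Jordan block of size three \<open>J\<^sub>r\<^sub>1\<close>
(\<open>classified_isotropic_flag\<close>). Once \<open>u\<close> is split off, adding multiples of \<open>v\<close> to \<open>w\<close> changes
\<open>B(w, w)\<close> by \<open>t + m t\<^sup>*\<close>. This is arbitrary if \<open>m\<close> is not unimodular, which leads to \<open>J\<^sub>r\<^sub>5\<close>,
and it sweeps out a real line if \<open>m\<close> is unimodular, which leads to \<open>J\<^sub>r\<^sub>2\<close>, \<open>J\<^sub>r\<^sub>3\<close> or back to
a diagonal matrix (\<open>classified_isotropic_split\<close>).\<close>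

section \<open>Congruence up to scaling\<close>

text \<open>\<open>M\<close> is read as the Gram matrix of a sesquilinear form, antilinear in its second argument, and
the columns of \<open>P\<close> as the vectors of a new basis.\<close>

definition congruence :: "complex^'n^'n \<Rightarrow> complex^'n^'n \<Rightarrow> complex^'n^'n" where
  "congruence P M = transpose P ** M ** map_matrix cnj P"

definition scaled_congruent :: "complex^'n^'n \<Rightarrow> complex^'n^'n \<Rightarrow> bool" where
  "scaled_congruent M N \<longleftrightarrow>
     (\<exists>c P. c \<noteq> 0 \<and> invertible P \<and> N = map_matrix ((*) c) (congruence P M))"

definition conj_transpose :: "complex^'n^'n \<Rightarrow> complex^'n^'n" where
  "conj_transpose M = map_matrix cnj (transpose M)"

lemma map_matrix_cnj_mult:
  fixes A :: "complex^'n^'m" and B :: "complex^'k^'n"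
  shows "map_matrix cnj (A ** B) = map_matrix cnj A ** map_matrix cnj B"
  by (simp add: vec_eq_iff matrix_matrix_mult_def)

lemma transpose_map_matrix: "transpose (map_matrix f A) = map_matrix f (transpose A)"
  by (simp add: vec_eq_iff transpose_def)

lemma map_matrix_cnj_cnj [simp]: "map_matrix cnj (map_matrix cnj A) = A"
  by (simp add: vec_eq_iff)

lemma map_matrix_times_mult:
  fixes A :: "complex^'n^'m" and B :: "complex^'k^'n"
  shows "map_matrix ((*) c) A ** B = map_matrix ((*) c) (A ** B)"
    and "A ** map_matrix ((*) c) B = map_matrix ((*) c) (A ** B)"
  by (simp_all add: vec_eq_iff matrix_matrix_mult_def sum_distrib_left mult_ac)

lemma map_matrix_times_times [simp]:
  "map_matrix ((*) (c::complex)) (map_matrix ((*) d) A) = map_matrix ((*) (c * d)) A"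
  by (simp add: vec_eq_iff mult.assoc)

lemma map_matrix_cnj_mat1 [simp]: "map_matrix cnj (mat 1) = mat 1"
  by (simp add: vec_eq_iff mat_def)

lemma congruence_congruence: "congruence P (congruence Q M) = congruence (Q ** P) M"
  by (simp add: congruence_def map_matrix_cnj_mult matrix_transpose_mul matrix_mul_assoc)

lemma congruence_mat1 [simp]: "congruence (mat 1) M = M"
  by (simp add: congruence_def transpose_mat)

lemma congruence_scale: "congruence P (map_matrix ((*) c) M) = map_matrix ((*) c) (congruence P M)"
  by (simp add: congruence_def map_matrix_times_mult)

lemma conj_transpose_congruence: "conj_transpose (congruence P M) = congruence P (conj_transpose M)"
  by (simp add: conj_transpose_def congruence_def matrix_transpose_mul map_matrix_cnj_mult transpose_map_matrix
      matrix_mul_assoc)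

lemma scaled_congruent_refl: "scaled_congruent M M"
proof -
  have "M = map_matrix ((*) 1) (congruence (mat 1) M)"
    by (simp add: vec_eq_iff)
  moreover have "invertible (mat 1 :: complex^'n^'n)"
    by (simp add: invertible_det_nz)
  ultimately show ?thesis
    unfolding scaled_congruent_def by (metis one_neq_zero)
qed

lemma scaled_congruent_trans:
  assumes "scaled_congruent A B" "scaled_congruent B C"
  shows "scaled_congruent A C"
proof -
  obtain c P where 1: "c \<noteq> 0" "invertible P" "B = map_matrix ((*) c) (congruence P A)"
    using assms(1) unfolding scaled_congruent_def by auto
  obtain d Q where 2: "d \<noteq> 0" "invertible Q" "C = map_matrix ((*) d) (congruence Q B)"
    using assms(2) unfolding scaled_congruent_def by auto
  have "C = map_matrix ((*) (d * c)) (congruence (P ** Q) A)"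
    unfolding 2(3) 1(3) congruence_scale congruence_congruence map_matrix_times_times ..
  then show ?thesis
    using 1 2 invertible_mult unfolding scaled_congruent_def by (metis mult_eq_0_iff)
qed

text \<open>Taking conjugate transposes commutes with congruence, so an invertible change of basis can be
undone without losing Hermitian symmetry; only the scalar survives.\<close>

lemma hermitian_scaled_congruent:
  assumes "scaled_congruent M N" "hermitian N"
  obtains c where "c \<noteq> 0" "hermitian (map_matrix ((*) c) M)"
proof -
  obtain c P where 1: "c \<noteq> 0" "invertible P" "N = map_matrix ((*) c) (congruence P M)"
    using assms(1) unfolding scaled_congruent_def by auto
  obtain Q where Q: "P ** Q = mat 1"
    using 1(2) unfolding invertible_def by auto
  have "N = conj_transpose N"
    using assms(2) unfolding hermitian_def conj_transpose_def .
  then have "congruence Q N = conj_transpose (congruence Q N)"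
    by (simp add: conj_transpose_congruence)
  moreover have "congruence Q N = map_matrix ((*) c) M"
    unfolding 1(3) by (simp add: congruence_scale congruence_congruence Q)
  ultimately have "hermitian (map_matrix ((*) c) M)"
    by (simp add: hermitian_def conj_transpose_def)
  then show ?thesis using that 1(1) by blast
qed

lemma invertible_scaled_congruent:
  assumes "scaled_congruent M N" "invertible M"
  shows "invertible N"
proof -
  obtain c P where 1: "c \<noteq> 0" "invertible P" "N = map_matrix ((*) c) (congruence P M)"
    using assms(1) unfolding scaled_congruent_def by auto
  obtain Q where Q: "P ** Q = mat 1" "Q ** P = mat 1"
    using 1(2) unfolding invertible_def by auto
  have "map_matrix cnj P ** map_matrix cnj Q = mat 1"
    by (simp flip: map_matrix_cnj_mult add: Q)
  then have "invertible (map_matrix cnj P)"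
    using invertible_right_inverse by blast
  then have inv: "invertible (congruence P M)"
    unfolding congruence_def using assms(2) 1(2)
    by (intro invertible_mult) (simp_all add: invertible_det_nz det_transpose)
  then obtain R where "congruence P M ** R = mat 1"
    unfolding invertible_def by auto
  then have "N ** map_matrix ((*) (1/c)) R = mat 1"
    unfolding 1(3) map_matrix_times_mult map_matrix_times_times using 1(1)
    by (simp add: vec_eq_iff)
  then show ?thesis using invertible_right_inverse by blast
qed

section \<open>Explicit matrices of size three\<close>

definition mat3 :: "complex \<Rightarrow> complex \<Rightarrow> complex \<Rightarrow> complex \<Rightarrow> complex \<Rightarrow> complex \<Rightarrow>
    complex \<Rightarrow> complex \<Rightarrow> complex \<Rightarrow> complex^3^3" where
  "mat3 a b c d e f g h i = vector [vector [a, b, c], vector [d, e, f], vector [g, h, i]]"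

lemma mat3_nth [simp]:
  "mat3 a b c d e f g h i $ 1 $ 1 = a" "mat3 a b c d e f g h i $ 1 $ 2 = b"
  "mat3 a b c d e f g h i $ 1 $ 3 = c" "mat3 a b c d e f g h i $ 2 $ 1 = d"
  "mat3 a b c d e f g h i $ 2 $ 2 = e" "mat3 a b c d e f g h i $ 2 $ 3 = f"
  "mat3 a b c d e f g h i $ 3 $ 1 = g" "mat3 a b c d e f g h i $ 3 $ 2 = h"
  "mat3 a b c d e f g h i $ 3 $ 3 = i"
  by (simp_all add: mat3_def)

lemma mat3_cases:
  obtains a b c d e f g h i where "M = mat3 a b c d e f g h i"
proof
  show "M = mat3 (M$1$1) (M$1$2) (M$1$3) (M$2$1) (M$2$2) (M$2$3) (M$3$1) (M$3$2) (M$3$3)"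
    by (simp add: vec_eq_iff forall_3)
qed

lemma hermitian_mat3:
  "hermitian (mat3 a b c d e f g h i) \<longleftrightarrow>
     cnj a = a \<and> cnj e = e \<and> cnj i = i \<and> d = cnj b \<and> g = cnj c \<and> h = cnj f"
  by (auto simp: hermitian_def vec_eq_iff forall_3 transpose_def)

lemma invertible_mat3:
  "invertible (mat3 a b c d e f g h i) \<longleftrightarrow>
     a * e * i + b * f * g + c * d * h - a * f * h - b * d * i - c * e * g \<noteq> 0"
  by (simp add: invertible_det_nz det_3)

lemma congruence_mat3:
  "congruence P M $ j $ k = (\<Sum>l\<in>UNIV. \<Sum>m\<in>UNIV. P $ l $ j * M $ l $ m * cnj (P $ m $ k))"
proof -
  have "congruence P M $ j $ k = (\<Sum>m\<in>UNIV. \<Sum>l\<in>UNIV. P $ l $ j * M $ l $ m * cnj (P $ m $ k))"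
    by (simp add: congruence_def matrix_matrix_mult_def transpose_def sum_distrib_right)
  then show ?thesis by (subst sum.swap)
qed

text \<open>The reductions below apply one explicit change of basis and then simplify each of the nine
entries; this rule leaves exactly these entrywise equations.\<close>

lemma scaled_congruent_mat3I:
  assumes "scaled_congruent M (mat3 a b c d e f g h i)"
    "a = a'" "b = b'" "c = c'" "d = d'" "e = e'" "f = f'" "g = g'" "h = h'" "i = i'"
  shows "scaled_congruent M (mat3 a' b' c' d' e' f' g' h' i')"
  using assms by simp

text \<open>The change of basis \<open>(e\<^sub>1, e\<^sub>2 + r e\<^sub>1, e\<^sub>3 + s e\<^sub>2 + t e\<^sub>1)\<close>. It preserves the flag spanned by the
basis and thus carries most of the reductions.\<close>

lemma scaled_congruent_upper:
  "scaled_congruent (mat3 a b c d e f g h i)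
     (mat3 a (b + a * cnj r) (c + b * cnj s + a * cnj t)
       (d + r * a) (e + r * b + d * cnj r + r * a * cnj r)
         (f + r * c + e * cnj s + r * b * cnj s + d * cnj t + r * a * cnj t)
       (g + s * d + t * a) (h + s * e + t * b + g * cnj r + s * d * cnj r + t * a * cnj r)
         (i + s * f + t * c + h * cnj s + s * e * cnj s + t * b * cnj s
            + g * cnj t + s * d * cnj t + t * a * cnj t))"
  unfolding scaled_congruent_def
  by (rule exI[of _ 1], rule exI[of _ "mat3 1 r t 0 1 s 0 0 1"])
     (simp add: invertible_mat3 vec_eq_iff forall_3 congruence_mat3 sum_3 algebra_simps)

text \<open>The change of basis \<open>(e\<^sub>1, e\<^sub>2 + s e\<^sub>3, e\<^sub>3)\<close>.\<close>

lemma scaled_congruent_add32: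
  "scaled_congruent (mat3 a b c d e f g h i)
     (mat3 a (b + cnj s * c) c
       (d + s * g) (e + s * h + cnj s * (f + s * i)) (f + s * i)
       g (h + cnj s * i) i)"
  unfolding scaled_congruent_def
  by (rule exI[of _ 1], rule exI[of _ "mat3 1 0 0 0 1 0 0 s 1"])
     (simp add: invertible_mat3 vec_eq_iff forall_3 congruence_mat3 sum_3 algebra_simps)

lemma scaled_congruent_scale:
  assumes "k \<noteq> 0" "x \<noteq> 0" "y \<noteq> 0" "z \<noteq> 0"
  shows "scaled_congruent (mat3 a b c d e f g h i)
     (mat3 (k * x * cnj x * a) (k * x * cnj y * b) (k * x * cnj z * c)
       (k * y * cnj x * d) (k * y * cnj y * e) (k * y * cnj z * f)
       (k * z * cnj x * g) (k * z * cnj y * h) (k * z * cnj z * i))"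
  unfolding scaled_congruent_def using assms
  by (intro exI[of _ k] exI[of _ "mat3 x 0 0 0 y 0 0 0 z"])
     (simp add: invertible_mat3 vec_eq_iff forall_3 congruence_mat3 sum_3 algebra_simps)

lemma scaled_congruent_swap12:
  "scaled_congruent (mat3 a b c d e f g h i) (mat3 e d f b a c h g i)"
  unfolding scaled_congruent_def
  by (intro exI[of _ 1] exI[of _ "mat3 0 1 0 1 0 0 0 0 1"])
     (simp add: invertible_mat3 vec_eq_iff forall_3 congruence_mat3 sum_3)

lemma scaled_congruent_swap23:
  "scaled_congruent (mat3 a b c d e f g h i) (mat3 a c b g i h d f e)"
  unfolding scaled_congruent_def
  by (intro exI[of _ 1] exI[of _ "mat3 1 0 0 0 0 1 0 1 0"])
     (simp add: invertible_mat3 vec_eq_iff forall_3 congruence_mat3 sum_3)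

text \<open>The change of basis \<open>(e\<^sub>1, p e\<^sub>2 + q e\<^sub>3, r e\<^sub>2 + s e\<^sub>3)\<close>.\<close>

lemma scaled_congruent_mix23:
  assumes "p * s - q * r \<noteq> 0"
  shows "scaled_congruent (mat3 a 0 0 0 e f 0 h i)
    (mat3 a 0 0
       0 (p * e * cnj p + p * f * cnj q + q * h * cnj p + q * i * cnj q)
         (p * e * cnj r + p * f * cnj s + q * h * cnj r + q * i * cnj s)
       0 (r * e * cnj p + r * f * cnj q + s * h * cnj p + s * i * cnj q)
         (r * e * cnj r + r * f * cnj s + s * h * cnj r + s * i * cnj s))"
  unfolding scaled_congruent_def using assms
  by (intro exI[of _ 1] exI[of _ "mat3 1 0 0 0 p r 0 q s"])
     (simp add: invertible_mat3 vec_eq_iff forall_3 congruence_mat3 sum_3 algebra_simps)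

section \<open>The normal forms\<close>

text \<open>The cases correspond in order to \<open>J\<^sub>r\<^sub>1\<close>, to \<open>J\<^sub>r\<^sub>2\<close> and \<open>J\<^sub>r\<^sub>3\<close> together, and to \<open>J\<^sub>r\<^sub>4\<^sub>+\<close>, \<open>J\<^sub>r\<^sub>4\<^sub>-\<close>,
\<open>J\<^sub>r\<^sub>5\<close> and \<open>J\<^sub>r\<^sub>6\<close>. Conditions on unit complex numbers are expressed by signs of imaginary parts,
which behave better under inversion and negation than arguments do.\<close>

inductive standard_form :: "complex^3^3 \<Rightarrow> bool" where
  jordan3: "standard_form (mat3 0 0 1 0 1 \<i> 1 \<i> 0)"
| jordan2: "cmod z = 1 \<Longrightarrow> standard_form (mat3 0 1 0 1 \<i> 0 0 0 z)"
| diag_plus: "cmod z = 1 \<Longrightarrow> Im z \<noteq> 0 \<Longrightarrow> standard_form (mat3 1 0 0 0 1 0 0 0 z)"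
| diag_minus: "cmod z = 1 \<Longrightarrow> Im z > 0 \<Longrightarrow> standard_form (mat3 1 0 0 0 (-1) 0 0 0 z)"
| hyperbolic: "cmod z > 1 \<Longrightarrow> standard_form (mat3 0 1 0 z 0 0 0 0 1)"
| diag_generic: "cmod z = 1 \<Longrightarrow> Im z \<noteq> 0 \<Longrightarrow> cmod w = 1 \<Longrightarrow> Im w > 0 \<Longrightarrow>
    z \<noteq> w \<Longrightarrow> z \<noteq> - w \<Longrightarrow> standard_form (mat3 1 0 0 0 z 0 0 0 w)"

text \<open>A form proportional to a Hermitian one ends as a Hermitian matrix. Counting this as an admissible
outcome lets each reduction be stated for all matrices of its shape; the two outcomes are told
apart only at the very end.\<close>

definition classified :: "complex^3^3 \<Rightarrow> bool" where
  "classified M \<longleftrightarrow> (\<exists>N. scaled_congruent M N \<and> (standard_form N \<or> hermitian N))"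

lemma classified_scaled_congruent:
  "scaled_congruent M N \<Longrightarrow> classified N \<Longrightarrow> classified M"
  unfolding classified_def using scaled_congruent_trans by blast

lemma classifiedI: "standard_form N \<or> hermitian N \<Longrightarrow> classified N"
  unfolding classified_def using scaled_congruent_refl by blast

section \<open>Diagonal matrices\<close>

lemma unit_upper_half_plane_exp:
  assumes "cmod z = 1" "Im z > 0"
  obtains \<theta> where "z = exp (\<i> * complex_of_real \<theta>)" "0 < \<theta>" "\<theta> < pi"
proof
  have "z \<noteq> 0" using assms by auto
  then show "z = exp (\<i> * complex_of_real (Arg z))"
    using Arg_eq[of z] assms by simp
  show "0 < Arg z" "Arg z < pi"
    using Arg_lt_pi[of z] assms \<open>z \<noteq> 0\<close> by auto
qed

lemma unit_Im_eq_0_iff: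
  assumes "cmod z = 1"
  shows "Im z = 0 \<longleftrightarrow> z = 1 \<or> z = -1"
proof
  assume "Im z = 0"
  then have "\<bar>Re z\<bar> = 1" using assms by (simp add: cmod_eq_Re)
  then show "z = 1 \<or> z = -1" using \<open>Im z = 0\<close> by (auto simp: complex_eq_iff abs_if split: if_splits)
qed auto

abbreviation diag3 :: "complex \<Rightarrow> complex \<Rightarrow> complex \<Rightarrow> complex^3^3" where
  "diag3 a b c \<equiv> mat3 a 0 0 0 b 0 0 0 c"

lemma diag3_swap12: "classified (diag3 b a c) \<Longrightarrow> classified (diag3 a b c)"
  using classified_scaled_congruent scaled_congruent_swap12 by blast

lemma diag3_swap23: "classified (diag3 a c b) \<Longrightarrow> classified (diag3 a b c)"
  using classified_scaled_congruent scaled_congruent_swap23 by blast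

lemma diag3_scale:
  "k \<noteq> 0 \<Longrightarrow> classified (diag3 (k * a) (k * b) (k * c)) \<Longrightarrow> classified (diag3 a b c)"
  by (rule classified_scaled_congruent[OF scaled_congruent_scale[of k 1 1 1]]) auto

text \<open>If \<open>z\<close> is real the matrix is Hermitian. For \<open>e = -1\<close>, changing the sign of the whole matrix and
swapping the first two basis vectors replaces \<open>z\<close> by \<open>-z\<close>, so that \<open>z\<close> may be taken in the upper
half plane.\<close>

lemma classified_diag3_pm:
  assumes "cmod z = 1" "e = 1 \<or> e = -1"
  shows "classified (diag3 1 e z)"
proof (cases "Im z = 0")
  case True
  then show ?thesis using assms
    by (intro classifiedI disjI2) (auto simp: hermitian_mat3 complex_eq_iff)
next
  case False
  show ?thesis
  proof (cases "e = 1")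
    case True
    then show ?thesis using assms False by (auto intro: classifiedI diag_plus)
  next
    case e: False
    have up: "classified (diag3 1 (-1) w)" if "cmod w = 1" "Im w > 0" for w
      using that by (auto intro: classifiedI diag_minus)
    show ?thesis
    proof (cases "Im z > 0")
      case True
      then show ?thesis using up[of z] assms e by auto
    next
      case F: False
      have "classified (diag3 1 (-1) (-z))"
        using up[of "-z"] assms F False by auto
      then have "classified (diag3 (-1) 1 (-z))" by (rule diag3_swap12)
      then show ?thesis using diag3_scale[of "-1" 1 e z] e assms by auto
    qed
  qed
qed

text \<open>Two of the three real lines through \<open>1\<close>, \<open>z\<close>, \<open>w\<close> may coincide, and rescaling moves these
entries to the first two places. If no two coincide, one has to bring a diagonal entry into the
upper half plane: if \<open>z\<close> and \<open>w\<close> are both in the lower one, dividing by \<open>z\<close> turns the entry \<open>1\<close>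
into \<open>1/z\<close>, which lies in the upper one.\<close>

lemma classified_diag3_unit:
  assumes z: "cmod z = 1" and w: "cmod w = 1"
  shows "classified (diag3 1 z w)"
proof -
  have zw0: "z \<noteq> 0" "w \<noteq> 0" using z w by auto
  consider "z = 1 \<or> z = -1" | "w = 1 \<or> w = -1" | "w = z \<or> w = -z"
    | "z \<noteq> 1" "z \<noteq> -1" "w \<noteq> 1" "w \<noteq> -1" "z \<noteq> w" "z \<noteq> -w" by force
  then show ?thesis
  proof cases
    case 1
    then show ?thesis using classified_diag3_pm w by blast
  next
    case 2
    then show ?thesis by (rule diag3_swap23[OF classified_diag3_pm[OF z]])
  next
    case 3
    have "classified (diag3 1 (w/z) (1/z))"
      using 3 zw0 z by (intro classified_diag3_pm) (auto simp: norm_divide)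
    then have "classified (diag3 (1/z) 1 (w/z))"
      by (rule diag3_swap23[THEN diag3_swap12])
    then show ?thesis using diag3_scale[of "1/z" 1 z w] zw0 by auto
  next
    case 4
    have up: "classified (diag3 1 x y)"
      if "cmod x = 1" "Im x \<noteq> 0" "cmod y = 1" "Im y > 0" "x \<noteq> y" "x \<noteq> -y" for x y
      using that by (auto intro: classifiedI diag_generic)
    have im: "Im z \<noteq> 0" "Im w \<noteq> 0" using 4 unit_Im_eq_0_iff z w by auto
    then consider "Im w > 0" | "Im z > 0" | "Im z < 0" by linarith
    then show ?thesis
    proof cases
      case 1
      then show ?thesis using up 4 im z w by blast
    next
      case 2
      then show ?thesis using 4 im z w by (intro diag3_swap23[OF up]) auto
    next
      case 3
      have eq: "1 / z = cnj z" using z by (simp add: divide_conv_cnj)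
      have "classified (diag3 1 (w/z) (1/z))"
      proof (rule up)
        show "Im (1/z) > 0" unfolding eq using 3 by simp
        have "w/z \<noteq> 1" "w/z \<noteq> -1" using 4 zw0 by (auto simp: field_simps)
        then show "Im (w/z) \<noteq> 0" using unit_Im_eq_0_iff[of "w/z"] z w by (simp add: norm_divide)
        show "w/z \<noteq> -(1/z)" using 4 zw0 by (auto simp: field_simps)
      qed (use 4 zw0 z w in \<open>auto simp: norm_divide\<close>)
      then have "classified (diag3 (1/z) 1 (w/z))"
        by (rule diag3_swap23[THEN diag3_swap12])
      then show ?thesis using diag3_scale[of "1/z" 1 z w] zw0 by auto
    qed
  qed
qed

lemma sqrt_scale_unit:
  assumes "z \<noteq> 0"
  obtains r :: real where "r > 0" "cmod (of_real r * of_real r * z) = 1"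
proof
  show "1 / sqrt (cmod z) > 0" using assms by simp
  have "1 / sqrt (cmod z) * (1 / sqrt (cmod z)) * cmod z = 1" using assms by simp
  then show "cmod (of_real (1 / sqrt (cmod z)) * of_real (1 / sqrt (cmod z)) * z) = 1"
    by (simp add: norm_mult norm_divide)
qed

lemma classified_diag3:
  assumes "a \<noteq> 0" "b \<noteq> 0" "c \<noteq> 0"
  shows "classified (diag3 a b c)"
proof -
  obtain r where r: "r > 0" "cmod (of_real r * of_real r * (b/a)) = 1"
    using sqrt_scale_unit[of "b/a"] assms by auto
  obtain s where s: "s > 0" "cmod (of_real s * of_real s * (c/a)) = 1"
    using sqrt_scale_unit[of "c/a"] assms by auto
  have "scaled_congruent (diag3 a b c)
      (diag3 1 (of_real r * of_real r * (b/a)) (of_real s * of_real s * (c/a)))"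
    by (rule scaled_congruent_mat3I[OF scaled_congruent_scale[of "1/a" 1 "of_real r" "of_real s"]])
       (use r s assms in auto)
  then show ?thesis
    using classified_scaled_congruent classified_diag3_unit[OF r(2) s(2)] by blast
qed

section \<open>Matrices with an isotropic eigenvector\<close>

text \<open>The hyperbolic plane with \<open>B(w, w) = \<i> b\<close>. For \<open>b \<noteq> 0\<close>, rescaling \<open>w\<close> normalizes the modulus of
\<open>b\<close>, and the sign of \<open>b\<close> is absorbed by the overall scalar. For \<open>b = 0\<close> the plane is Hermitian,
and the sum and the difference of the two isotropic vectors diagonalize it.\<close>

lemma classified_delta2:
  assumes z: "cmod z = 1"
  shows "classified (mat3 0 1 0 1 (\<i> * of_real b) 0 0 0 z)"
proof (cases "b = 0")
  case True
  have "scaled_congruent (mat3 0 1 0 1 0 0 0 0 z) (diag3 2 (-2) z)"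
    unfolding scaled_congruent_def
    by (intro exI[of _ 1] exI[of _ "mat3 1 1 0 1 (-1) 0 0 0 1"])
       (simp add: invertible_mat3 vec_eq_iff forall_3 congruence_mat3 sum_3)
  moreover have "classified (diag3 2 (-2) z)" using z by (intro classified_diag3) auto
  ultimately show ?thesis using True classified_scaled_congruent by auto
next
  case False
  define k where "k = sgn b"
  define y where "y = 1 / sqrt \<bar>b\<bar>"
  have k: "k = 1 \<or> k = -1" and y: "y \<noteq> 0" and ky: "k * y * y * b = 1"
    using False by (auto simp: k_def y_def sgn_if)
  have "scaled_congruent (mat3 0 1 0 1 (\<i> * of_real b) 0 0 0 z)
      (mat3 0 1 0 1 \<i> 0 0 0 (of_real k * z))"
  proof (rule scaled_congruent_mat3I[OF
        scaled_congruent_scale[of "of_real k" "of_real (k / y)" "of_real y" 1]])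
    have "complex_of_real k * of_real y * cnj (of_real y) * (\<i> * of_real b)
        = of_real (k * y * y * b) * \<i>"
      by simp
    then show "complex_of_real k * of_real y * cnj (of_real y) * (\<i> * of_real b) = \<i>"
      unfolding ky by simp
  qed (use k y in auto)
  moreover have "standard_form (mat3 0 1 0 1 \<i> 0 0 0 (of_real k * z))"
    using k z by (auto intro!: jordan2 simp: norm_mult)
  ultimately show ?thesis unfolding classified_def by blast
qed

text \<open>Replacing \<open>e\<^sub>3\<close> by \<open>e\<^sub>3 + t e\<^sub>1\<close> changes \<open>d\<close> by \<open>t + m t\<^sup>*\<close>. As a real-linear map of \<open>t\<close> this is bijective
if \<open>m\<close> is not unimodular; the plane of \<open>e\<^sub>1\<close> and \<open>e\<^sub>3\<close> then has zero diagonal, and swapping its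
basis replaces \<open>m\<close> by \<open>1 / m\<^sup>*\<close>, so that one may assume modulus greater than one. If \<open>m = n\<^sup>2\<close> with
\<open>n\<close> unimodular, the image is the real line \<open>\<real> n\<close>, and \<open>d\<close> can be moved into \<open>\<i> \<real> n\<close>.\<close>

lemma classified_isotropic_split:
  assumes m: "m \<noteq> 0"
  shows "classified (mat3 0 0 1 0 1 0 m 0 d)"
proof (cases "cmod m = 1")
  case True
  define n where "n = csqrt m"
  have n2: "n * n = m" by (simp add: n_def flip: power2_eq_square)
  have n1: "cmod n = 1" using True by (simp add: n_def)
  have nn: "n * cnj n = 1" using n1 by (simp add: complex_norm_square[symmetric])
  then have nn': "cnj n * n = 1" by (simp add: mult.commute)
  have n0: "n \<noteq> 0" using n1 by auto
  \<comment> \<open>The value \<open>t + m t\<^sup>*\<close> cancels the component of \<open>d\<close> along \<open>n\<close>.\<close>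
  define t where "t = - n * of_real (Re (d / n)) / 2"
  have t: "d + t + m * cnj t = n * (\<i> * of_real (Im (d / n)))"
  proof -
    have mn: "m * cnj n = n"
      by (simp add: mult.assoc nn flip: n2)
    have "m * cnj t = - (m * cnj n) * of_real (Re (d / n)) / 2"
      by (simp add: t_def)
    then have "m * cnj t = t"
      unfolding mn by (simp add: t_def)
    then have "t + m * cnj t = t + t" by simp
    also have "\<dots> = - n * of_real (Re (d / n))" by (simp add: t_def)
    finally have "t + m * cnj t = - n * of_real (Re (d / n))" .
    moreover have "d = n * (of_real (Re (d/n)) + \<i> * of_real (Im (d/n)))"
      using complex_eq[of "d/n"] n0 by (simp add: field_simps)
    ultimately show ?thesis by (simp add: algebra_simps)
  qed
  have "scaled_congruent (mat3 0 0 1 0 1 0 m 0 d) (mat3 0 0 1 0 1 0 m 0 (d + t + m * cnj t))"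
    by (rule scaled_congruent_mat3I[OF scaled_congruent_upper[where r = 0 and s = 0 and t = t]]) auto
  moreover have "scaled_congruent (mat3 0 0 1 0 1 0 m 0 (d + t + m * cnj t))
      (mat3 0 0 1 0 (1/n) 0 1 0 (\<i> * of_real (Im (d / n))))"
    by (rule scaled_congruent_mat3I[OF scaled_congruent_scale[of "1/n" n 1 1]])
       (use n0 nn nn' t in \<open>auto simp: mult.assoc simp flip: n2\<close>)
  moreover have "scaled_congruent (mat3 0 0 1 0 (1/n) 0 1 0 (\<i> * of_real (Im (d / n))))
      (mat3 0 1 0 1 (\<i> * of_real (Im (d / n))) 0 0 0 (1/n))"
    by (rule scaled_congruent_swap23)
  moreover have "classified (mat3 0 1 0 1 (\<i> * of_real (Im (d / n))) 0 0 0 (1/n))"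
    using n1 by (intro classified_delta2) (simp add: norm_divide)
  ultimately show ?thesis using classified_scaled_congruent by meson
next
  case False
  \<comment> \<open>The solution of \<open>t + m t\<^sup>* = - d\<close>.\<close>
  define t where "t = (m * cnj d - d) / (1 - m * cnj m)"
  have "m * cnj m \<noteq> 1"
    using False by (metis complex_norm_square norm_ge_zero of_real_eq_1_iff power2_eq_1_iff
        add.inverse_neutral neg_le_iff_le not_one_le_zero order.trans zero_le_one)
  then have nz: "1 - m * cnj m \<noteq> 0" by simp
  have t: "d + t + m * cnj t = 0"
  proof -
    have "cnj t = (cnj m * d - cnj d) / (1 - m * cnj m)"
      by (simp add: t_def mult.commute)
    then show ?thesis using nz by (simp add: t_def divide_simps) (simp add: algebra_simps)
  qed
  have 1: "scaled_congruent (mat3 0 0 1 0 1 0 m 0 d) (mat3 0 0 1 0 1 0 m 0 0)"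
    by (rule scaled_congruent_mat3I[OF scaled_congruent_upper[where r = 0 and s = 0 and t = t]])
       (use t in auto)
  have 2: "scaled_congruent (mat3 0 0 1 0 1 0 m 0 0) (mat3 0 1 0 m 0 0 0 0 1)"
    by (rule scaled_congruent_swap23)
  have "classified (mat3 0 1 0 m 0 0 0 0 1)"
  proof (cases "cmod m > 1")
    case True
    then show ?thesis by (intro classifiedI disjI1 hyperbolic)
  next
    case le: False
    have "scaled_congruent (mat3 0 1 0 m 0 0 0 0 1) (mat3 0 m 0 1 0 0 0 0 1)"
      by (rule scaled_congruent_swap12)
    moreover have "scaled_congruent (mat3 0 m 0 1 0 0 0 0 1) (mat3 0 1 0 (1 / cnj m) 0 0 0 0 1)"
      by (rule scaled_congruent_mat3I[OF scaled_congruent_scale[of 1 "1/m" 1 1]]) (use m in auto)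
    moreover have "classified (mat3 0 1 0 (1 / cnj m) 0 0 0 0 1)"
      using le False m by (intro classifiedI disjI1 hyperbolic) (auto simp: norm_divide)
    ultimately show ?thesis using classified_scaled_congruent by meson
  qed
  then show ?thesis using 1 2 classified_scaled_congruent by meson
qed

text \<open>Replacing \<open>e\<^sub>2\<close> by \<open>e\<^sub>2 + r e\<^sub>1\<close> and \<open>e\<^sub>3\<close> by \<open>e\<^sub>3 + s e\<^sub>2\<close> turns \<open>q\<close> into \<open>q + r + s\<^sup>*\<close> and \<open>p\<close> into
\<open>p + s + m r\<^sup>*\<close>. Both can be made zero, except when \<open>m = 1\<close>: then \<open>p - q\<^sup>*\<close> is invariant. If this
invariant is not zero, \<open>p\<close> and \<open>q\<close> can both be turned into \<open>\<i>\<close>, whereupon \<open>d\<close> is removed by the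
real shifts that keep \<open>p\<close> and \<open>q\<close> fixed.\<close>

lemma classified_isotropic_flag:
  assumes m: "m \<noteq> 0"
  shows "classified (mat3 0 0 1 0 1 q m p d)"
proof (cases "m = 1 \<and> p \<noteq> cnj q")
  case False
  define s where "s = (if m = 1 then 0 else (m * cnj q - p) / (1 - m))"
  define r where "r = - q - cnj s"
  have p: "p + s + m * cnj r = 0"
    using False by (auto simp: r_def s_def divide_simps) (auto simp: algebra_simps)
  obtain d' where "scaled_congruent (mat3 0 0 1 0 1 q m p d) (mat3 0 0 1 0 1 0 m 0 d')"
    by (rule that, rule scaled_congruent_mat3I[OF scaled_congruent_upper[where r = r and s = s and t = 0]])
       (use p in \<open>auto simp: r_def\<close>)
  then show ?thesis using classified_isotropic_split[OF m] classified_scaled_congruent by blast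
next
  case True
  \<comment> \<open>After the shift by \<open>r\<close> the entries are \<open>\<i> x\<close> and \<open>\<i> y\<close> with \<open>x\<close> conjugate to \<open>y\<close>, so one rescaling of
    \<open>e\<^sub>1\<close> and \<open>e\<^sub>3\<close> turns both into \<open>\<i>\<close>; the invariant \<open>p - q\<^sup>*\<close> equals \<open>2 \<i> y\<close>.\<close>
  define y where "y = (p - cnj q) / (2 * \<i>)"
  define x where "x = cnj y"
  define r where "r = \<i> * x - q"
  have y0: "y \<noteq> 0" and x0: "x \<noteq> 0" using True by (auto simp: y_def x_def)
  have y: "\<i> * y = p + cnj r"
    by (simp add: y_def r_def x_def) (simp add: field_simps)
  obtain d' where 1: "scaled_congruent (mat3 0 0 1 0 1 q m p d) (mat3 0 0 1 0 1 (\<i> * x) 1 (\<i> * y) d')"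
    by (rule that, rule scaled_congruent_mat3I[OF scaled_congruent_upper[where r = r and s = 0 and t = 0]])
       (use y True in \<open>auto simp: r_def\<close>)
  obtain d2 where 2: "scaled_congruent (mat3 0 0 1 0 1 (\<i> * x) 1 (\<i> * y) d') (mat3 0 0 1 0 1 \<i> 1 \<i> d2)"
    by (rule that, rule scaled_congruent_mat3I[OF scaled_congruent_scale[of 1 x 1 "1 / y"]])
       (use x0 y0 in \<open>auto simp: x_def\<close>)
  \<comment> \<open>With \<open>r = - s\<close> and \<open>s\<close>, \<open>t\<close> real, \<open>d2\<close> changes by \<open>2 \<i> s + s\<^sup>2 + 2 t\<close>: \<open>s\<close> removes the imaginary part
    and \<open>t\<close> the real part.\<close>
  define s where "s = - Im d2 / 2"
  define t where "t = - (Re d2 + s\<^sup>2) / 2"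
  have 3: "scaled_congruent (mat3 0 0 1 0 1 \<i> 1 \<i> d2) (mat3 0 0 1 0 1 \<i> 1 \<i> 0)"
    by (rule scaled_congruent_mat3I[OF scaled_congruent_upper
          [where r = "- of_real s" and s = "of_real s" and t = "of_real t"]])
       (auto simp: complex_eq_iff t_def s_def power2_eq_square field_simps)
  have "classified (mat3 0 0 1 0 1 \<i> 1 \<i> 0)"
    by (intro classifiedI disjI1 jordan3)
  then show ?thesis using 1 2 3 classified_scaled_congruent by meson
qed

section \<open>Eigenvectors of the pencil of a matrix and its conjugate transpose\<close>

text \<open>For the form \<open>B\<close> with Gram matrix \<open>M\<close> this says that \<open>B(v, y)\<close> is \<open>l\<close> times the conjugate of
\<open>B(y, v)\<close> for every \<open>y\<close>. The relation is linear in \<open>v\<close> and does not depend on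
the choice of a basis.\<close>

definition eigenrow :: "complex^'n^'n \<Rightarrow> complex \<Rightarrow> complex^'n \<Rightarrow> bool" where
  "eigenrow M l v \<longleftrightarrow> v v* M = l *s (v v* conj_transpose M)"

lemma poly_root_deg3:
  assumes "d \<noteq> (0::complex)"
  obtains z where "a + b * z + c * z^2 + d * z^3 = 0"
proof -
  have "\<not> constant (poly [:a, b, c, d:])"
    using assms by (simp add: constant_degree)
  then obtain z where "poly [:a, b, c, d:] z = 0"
    using fundamental_theorem_of_algebra by blast
  then show ?thesis
    by (intro that[of z]) (simp add: algebra_simps power2_eq_square power3_eq_cube)
qed

lemma poly_root_deg2:
  assumes "c \<noteq> (0::complex)"
  obtains z where "a + b * z + c * z^2 = 0"
proof -
  have "\<not> constant (poly [:a, b, c:])"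
    using assms by (simp add: constant_degree)
  then obtain z where "poly [:a, b, c:] z = 0"
    using fundamental_theorem_of_algebra by blast
  then show ?thesis
    by (intro that[of z]) (simp add: algebra_simps power2_eq_square)
qed

lemma singular_pencil_eigenrow:
  assumes "det (M - map_matrix ((*) l) (conj_transpose M)) = 0"
  obtains v where "v \<noteq> 0" "eigenrow M l v"
proof -
  let ?A = "M - map_matrix ((*) l) (conj_transpose M)"
  have "\<not> invertible (transpose ?A)"
    using assms by (simp add: invertible_det_nz det_transpose)
  then obtain v where "v \<noteq> 0" "transpose ?A *v v = 0"
    using matrix_left_invertible_ker[of "transpose ?A"] unfolding invertible_left_inverse by auto
  then have v: "v v* ?A = 0" by (simp add: transpose_matrix_vector)
  have "eigenrow M l v"
    unfolding eigenrow_def vec_eq_iff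
  proof
    fix k
    have "(v v* ?A) $ k = 0" by (simp add: v)
    then show "(v v* M) $ k = (l *s (v v* conj_transpose M)) $ k"
      by (simp add: vector_matrix_mult_def sum_subtractf sum_distrib_left algebra_simps)
  qed
  then show ?thesis using that \<open>v \<noteq> 0\<close> by blast
qed

text \<open>The cubic polynomial \<open>det (M - l M\<^sup>\<dagger>)\<close> has constant term \<open>det M \<noteq> 0\<close> and leading coefficient
\<open>- (det M)\<^sup>*\<close>, so it has a root and the root is not zero.\<close>

lemma exists_eigenrow:
  assumes "invertible (M :: complex^3^3)"
  obtains l v where "l \<noteq> 0" "v \<noteq> 0" "eigenrow M l v"
proof -
  obtain a b c d e f g h i where M: "M = mat3 a b c d e f g h i" by (rule mat3_cases)
  have inv: "a * e * i + b * f * g + c * d * h - a * f * h - b * d * i - c * e * g \<noteq> 0"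
    using assms unfolding M invertible_mat3 .
  define D where "D = (\<lambda>a b c d e f g h i :: complex.
    a * e * i + b * f * g + c * d * h - a * f * h - b * d * i - c * e * g)"
  have D: "D a b c d e f g h i \<noteq> 0" using inv by (simp add: D_def)
  have "cnj (D a b c d e f g h i) \<noteq> 0" using D by simp
  then have "- cnj (D a b c d e f g h i) \<noteq> 0" by simp
  \<comment> \<open>The coefficients come from multilinearity of the determinant in the rows: the term of degree
    \<open>k\<close> collects the choices of \<open>k\<close> rows from \<open>M\<^sup>\<dagger>\<close>.\<close>
  then obtain l where l: "D a b c d e f g h i
      + - (D (cnj a) (cnj d) (cnj g) d e f g h i + D a b c (cnj b) (cnj e) (cnj h) g h i
          + D a b c d e f (cnj c) (cnj f) (cnj i)) * l
      + (D (cnj a) (cnj d) (cnj g) (cnj b) (cnj e) (cnj h) g h i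
          + D (cnj a) (cnj d) (cnj g) d e f (cnj c) (cnj f) (cnj i)
          + D a b c (cnj b) (cnj e) (cnj h) (cnj c) (cnj f) (cnj i)) * l ^ 2
      + (- cnj (D a b c d e f g h i)) * l ^ 3 = 0"
    by (rule poly_root_deg3)
  have "l \<noteq> 0" using l D by (auto simp: power2_eq_square power3_eq_cube)
  moreover have "det (M - map_matrix ((*) l) (conj_transpose M)) = 0"
    unfolding l[symmetric]
    by (simp add: M D_def det_3 conj_transpose_def transpose_def algebra_simps power2_eq_square
        power3_eq_cube)
  then obtain v where "v \<noteq> 0" "eigenrow M l v"
    by (rule singular_pencil_eigenrow)
  ultimately show ?thesis using that by blast
qed

lemma exists_matrix_with_column:
  assumes "v \<noteq> (0 :: complex^3)"
  obtains P :: "complex^3^3" where "invertible P" "column 1 P = v"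
proof -
  have col: "column 1 (mat3 (v$1) a b (v$2) c d (v$3) e f) = v" for a b c d e f
    by (simp add: column_def vec_eq_iff forall_3)
  from assms consider "v$1 \<noteq> 0" | "v$2 \<noteq> 0" | "v$3 \<noteq> 0"
    by (auto simp: vec_eq_iff forall_3)
  then show ?thesis
  proof cases
    case 1
    then show ?thesis
      by (intro that[OF _ col[of 0 0 1 0 0 1]]) (simp add: invertible_mat3)
  next
    case 2
    then show ?thesis
      by (intro that[OF _ col[of 1 0 0 0 0 1]]) (simp add: invertible_mat3)
  next
    case 3
    then show ?thesis
      by (intro that[OF _ col[of 1 0 0 1 0 0]]) (simp add: invertible_mat3)
  qed
qed

text \<open>With \<open>v\<close> as first basis vector, the eigenvector relation compares the first row with the first
column, and the corner entry is the value \<open>B(v, v)\<close>.\<close>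

lemma eigenrow_first_row:
  assumes "eigenrow M l v" "v \<noteq> (0 :: complex^3)"
  obtains N where "scaled_congruent M N" "\<forall>k. N $ 1 $ k = l * cnj (N $ k $ 1)"
    "N $ 1 $ 1 = (\<Sum>j\<in>UNIV. \<Sum>k\<in>UNIV. v $ j * M $ j $ k * cnj (v $ k))"
proof -
  obtain P :: "complex^3^3" where P: "invertible P" "column 1 P = v"
    using exists_matrix_with_column[OF assms(2)] .
  have P1: "P $ j $ 1 = v $ j" for j using P(2) by (auto simp: column_def)
  have sim: "scaled_congruent M (congruence P M)"
    unfolding scaled_congruent_def using P(1)
    by (intro exI[of _ 1] exI[of _ P]) (simp add: vec_eq_iff)
  show ?thesis
  proof (rule that[OF sim], rule allI)
    fix k
    have row: "congruence P X $ 1 $ k = (\<Sum>m\<in>UNIV. (v v* X) $ m * cnj (P $ m $ k))" for X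
      by (simp add: congruence_mat3 P1 vector_matrix_mult_def sum_3 algebra_simps)
    have "congruence P M $ 1 $ k = l * congruence P (conj_transpose M) $ 1 $ k"
      using assms(1) unfolding row eigenrow_def by (simp add: sum_distrib_left mult.assoc)
    also have "\<dots> = l * cnj (congruence P M $ k $ 1)"
      unfolding conj_transpose_congruence[symmetric] by (simp add: conj_transpose_def transpose_def)
    finally show "congruence P M $ 1 $ k = l * cnj (congruence P M $ k $ 1)" .
  qed (simp add: congruence_mat3 P1)
qed

section \<open>Classification of invertible matrices\<close>

text \<open>As \<open>e\<^sub>1\<close> is not orthogonal to \<open>e\<^sub>3\<close>, a multiple of \<open>e\<^sub>3\<close> makes \<open>e\<^sub>2\<close> orthogonal to \<open>e\<^sub>1\<close> on one side,
hence on both. Nondegeneracy then forces \<open>B(e\<^sub>2, e\<^sub>2) \<noteq> 0\<close>, and a rescaling yields the flag form.\<close>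

lemma classified_isotropic_row:
  assumes l: "l \<noteq> 0" and inv: "invertible (mat3 0 b c d e f g h i)"
    and b: "b = l * cnj d" and c: "c = l * cnj g" and g: "g \<noteq> 0"
  shows "classified (mat3 0 b c d e f g h i)"
proof -
  define s where "s = - d / g"
  have s: "d + s * g = 0" "b + cnj s * c = 0"
    using g by (simp_all add: s_def b c)
  obtain u p q where N: "scaled_congruent (mat3 0 b c d e f g h i) (mat3 0 0 c 0 u q g p i)"
    by (rule that, rule scaled_congruent_mat3I[OF scaled_congruent_add32[where s = s]]) (use s in auto)
  have "invertible (mat3 0 0 c 0 u q g p i)"
    using invertible_scaled_congruent[OF N inv] .
  then have u: "u \<noteq> 0" and c0: "c \<noteq> 0" by (auto simp: invertible_mat3)
  obtain q' p' i' where N2: "scaled_congruent (mat3 0 0 c 0 u q g p i)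
      (mat3 0 0 1 0 1 q' (g * cnj (u / c) / u) p' i')"
    by (rule that, rule scaled_congruent_mat3I[OF scaled_congruent_scale[of "1/u" "u/c" 1 1]])
       (use u c0 in \<open>auto simp: mult_ac\<close>)
  have "classified (mat3 0 0 1 0 1 q' (g * cnj (u / c) / u) p' i')"
    using u c0 g by (intro classified_isotropic_flag) auto
  then show ?thesis using N N2 classified_scaled_congruent by meson
qed

lemma classified_isotropic_eigenrow:
  assumes inv: "invertible M" and l: "l \<noteq> 0" and v: "v \<noteq> 0" "eigenrow M l v"
    and iso: "(\<Sum>j\<in>UNIV. \<Sum>k\<in>UNIV. v $ j * M $ j $ k * cnj (v $ k)) = 0"
  shows "classified M"
proof -
  obtain N where N: "scaled_congruent M N" "\<forall>k. N $ 1 $ k = l * cnj (N $ k $ 1)" "N $ 1 $ 1 = 0"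
    using eigenrow_first_row[OF v(2,1)] unfolding iso .
  obtain a b c d e f g h i where N': "N = mat3 a b c d e f g h i" by (rule mat3_cases)
  have a: "a = 0" and b: "b = l * cnj d" and c: "c = l * cnj g"
    using N(2)[rule_format, of 2] N(2)[rule_format, of 3] N(3) by (auto simp: N')
  have inv': "invertible (mat3 0 b c d e f g h i)"
    using invertible_scaled_congruent[OF N(1) inv] by (simp add: N' a)
  have "classified (mat3 0 b c d e f g h i)"
  proof (cases "g = 0")
    case False
    then show ?thesis using classified_isotropic_row[OF l inv' b c] by blast
  next
    case True
    have sw: "scaled_congruent (mat3 0 b c d e f g h i) (mat3 0 c b g i h d f e)"
      by (rule scaled_congruent_swap23)
    have "d \<noteq> 0" using inv' True by (auto simp: invertible_mat3)
    then have "classified (mat3 0 c b g i h d f e)"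
      using classified_isotropic_row[OF l invertible_scaled_congruent[OF sw inv'] c b] by blast
    then show ?thesis using sw classified_scaled_congruent by blast
  qed
  then show ?thesis using N(1) classified_scaled_congruent by (simp add: N' a)
qed

text \<open>The pencil argument for the block with rows \<open>(e, f)\<close> and \<open>(h, i)\<close>. The quadratic
polynomial has constant term \<open>e i - f h\<close> and the conjugate of it as leading coefficient, and in size
two a kernel vector of a singular matrix can be read off its entries.\<close>

lemma binary_eigenrow:
  assumes "e * i - f * h \<noteq> 0"
  obtains l x y where "l \<noteq> 0" "x \<noteq> 0 \<or> y \<noteq> 0"
    "x * e + y * h = l * (x * cnj e + y * cnj f)"
    "x * f + y * i = l * (x * cnj h + y * cnj i)"
proof -
  have "cnj (e * i - f * h) \<noteq> 0" using assms by (metis complex_cnj_zero_iff)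
  then obtain l where l: "(e * i - f * h)
      + (f * cnj f + h * cnj h - e * cnj i - i * cnj e) * l + cnj (e * i - f * h) * l ^ 2 = 0"
    using poly_root_deg2 by blast
  have l0: "l \<noteq> 0" using l assms by (auto simp: power2_eq_square)
  define A B C D where "A = e - l * cnj e" and "B = f - l * cnj h"
    and "C = h - l * cnj f" and "D = i - l * cnj i"
  have AD: "A * D = B * C"
  proof -
    have "A * D - B * C = (e * i - f * h)
      + (f * cnj f + h * cnj h - e * cnj i - i * cnj e) * l + cnj (e * i - f * h) * l ^ 2"
      by (simp add: A_def B_def C_def D_def algebra_simps power2_eq_square)
    then show ?thesis using l by simp
  qed
  obtain x y where xy: "x \<noteq> 0 \<or> y \<noteq> 0" "x * A + y * C = 0" "x * B + y * D = 0"
  proof (cases "A = 0 \<and> C = 0")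
    case False
    show ?thesis by (rule that[of C "- A"]) (use False AD in \<open>auto simp: mult.commute\<close>)
  next
    case AC: True
    show ?thesis
    proof (cases "B = 0 \<and> D = 0")
      case True
      then show ?thesis using AC by (intro that[of 1 0]) auto
    next
      case False
      then show ?thesis using AC by (intro that[of D "- B"]) (auto simp: mult.commute)
    qed
  qed
  show ?thesis
    by (rule that[OF l0 xy(1)]) (use xy(2,3) in \<open>simp_all add: A_def B_def C_def D_def algebra_simps\<close>)
qed

text \<open>An eigenvector of the block is an eigenvector of the whole matrix. If it is isotropic, the
isotropic case applies; otherwise its orthogonal complement in the plane diagonalizes the matrix.\<close>

lemma classified_block:
  assumes inv: "invertible (mat3 a 0 0 0 e f 0 h i)"
  shows "classified (mat3 a 0 0 0 e f 0 h i)"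
proof -
  have a: "a \<noteq> 0" and "a * (e * i - f * h) \<noteq> 0"
    using inv by (auto simp: invertible_mat3 algebra_simps)
  then have det: "e * i - f * h \<noteq> 0" by auto
  obtain l x y where l: "l \<noteq> 0" and xy: "x \<noteq> 0 \<or> y \<noteq> 0"
    and eig: "x * e + y * h = l * (x * cnj e + y * cnj f)"
      "x * f + y * i = l * (x * cnj h + y * cnj i)"
    using binary_eigenrow[OF det] .
  let ?M = "mat3 a 0 0 0 e f 0 h i"
  define v :: "complex^3" where "v = vector [0, x, y]"
  have v0: "v \<noteq> 0" using xy by (auto simp: v_def vec_eq_iff forall_3)
  have ev: "eigenrow ?M l v"
    using eig by (simp add: eigenrow_def v_def vec_eq_iff forall_3 vector_matrix_mult_def sum_3
        conj_transpose_def transpose_def mult.commute)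
  define n where "n = x * e * cnj x + x * f * cnj y + y * h * cnj x + y * i * cnj y"
  show ?thesis
  proof (cases "n = 0")
    case True
    then show ?thesis
      by (intro classified_isotropic_eigenrow[OF inv l v0 ev])
         (simp add: v_def sum_3 n_def algebra_simps)
  next
    case False
    \<comment> \<open>The vector \<open>r e\<^sub>2 + s e\<^sub>3\<close> spans the left orthogonal complement of the eigenvector in the plane. By
      the eigenvector relation it is also the right one.\<close>
    define r s where "r = h * cnj x + i * cnj y" and "s = - (e * cnj x + f * cnj y)"
    have "x * s - y * r = - n"
      by (simp add: r_def s_def n_def algebra_simps)
    then have "x * s - y * r \<noteq> 0" using False by simp
    note mix = scaled_congruent_mix23[OF this, of a e f h i]
    have left: "r * e * cnj x + r * f * cnj y + s * h * cnj x + s * i * cnj y = 0"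
      by (simp add: r_def s_def algebra_simps)
    have "x * e * cnj r + x * f * cnj s + y * h * cnj r + y * i * cnj s
        = (x * e + y * h) * cnj r + (x * f + y * i) * cnj s"
      by (simp add: algebra_simps)
    also have "\<dots> = 0"
      unfolding eig by (simp add: r_def s_def algebra_simps)
    finally have right: "x * e * cnj r + x * f * cnj s + y * h * cnj r + y * i * cnj s = 0" .
    obtain n' where sim: "scaled_congruent ?M (diag3 a n n')"
      by (rule that, rule scaled_congruent_mat3I[OF mix]) (use left right in \<open>auto simp: n_def\<close>)
    have "n' \<noteq> 0"
      using invertible_scaled_congruent[OF sim inv] by (auto simp: invertible_mat3)
    then show ?thesis
      using classified_scaled_congruent[OF sim] classified_diag3 a False by blast
  qed
qed

lemma invertible_classified:
  assumes inv: "invertible M"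
  shows "classified M"
proof -
  obtain l v where l: "l \<noteq> 0" and v: "v \<noteq> 0" "eigenrow M l v"
    using exists_eigenrow[OF inv] .
  define n where "n = (\<Sum>j\<in>UNIV. \<Sum>k\<in>UNIV. v $ j * M $ j $ k * cnj (v $ k))"
  show ?thesis
  proof (cases "n = 0")
    case True
    then show ?thesis
      using classified_isotropic_eigenrow[OF inv l v] by (simp add: n_def)
  next
    case False
    obtain N where N: "scaled_congruent M N" "\<forall>k. N $ 1 $ k = l * cnj (N $ k $ 1)" "N $ 1 $ 1 = n"
      using eigenrow_first_row[OF v(2,1)] unfolding n_def .
    obtain a b c d e f g h i where N': "N = mat3 a b c d e f g h i" by (rule mat3_cases)
    have a: "a \<noteq> 0" "a = l * cnj a" and b: "b = l * cnj d" and c: "c = l * cnj g"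
      using N(2)[rule_format, of 1] N(2)[rule_format, of 2] N(2)[rule_format, of 3] N(3) False
      by (auto simp: N')
    \<comment> \<open>Clearing an entry of the first column also clears its mirror image in the first row, since
      \<open>a = l a\<^sup>*\<close>.\<close>
    have clear: "l * cnj x + a * cnj (- x / a) = 0" for x
    proof -
      have "a * cnj (- x / a) = l * cnj a * cnj (- x / a)" using a(2) by simp
      also have "\<dots> = - l * cnj x" using a(1) by simp
      finally show ?thesis by simp
    qed
    obtain e' f' h' i' where
      "scaled_congruent (mat3 a b c d e f g h i) (mat3 a 0 0 0 e' f' 0 h' i')"
      by (rule that, rule scaled_congruent_mat3I[OF scaled_congruent_upper
            [where r = "- d / a" and s = 0 and t = "- g / a"]])
         (use a(1) clear[of d] clear[of g] in \<open>auto simp: b c\<close>)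
    then have sim: "scaled_congruent N (mat3 a 0 0 0 e' f' 0 h' i')"
      unfolding N' .
    have "classified (mat3 a 0 0 0 e' f' 0 h' i')"
      using inv N(1) sim invertible_scaled_congruent classified_block by blast
    then show ?thesis using N(1) sim classified_scaled_congruent by blast
  qed
qed

section \<open>Change of basis of the (1,0)-forms\<close>

lemma (in vector_space) card_spanning_eq_dim_imp_independent:
  assumes "finite S" "card S \<le> dim S"
  shows "independent S"
proof -
  obtain B where B: "B \<subseteq> S" "independent B" "S \<subseteq> span B" "card B = dim S"
    using basis_exists .
  then have "B = S" using assms by (simp add: card_seteq)
  then show ?thesis using B(2) by simp
qed

text \<open>By counting dimensions, a list that spans the same space and is no longer than a basis is
distinct and independent, so that only the two span inclusions have to be checked.\<close>

lemma basis10_change: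
  assumes basis: "basis10 J \<omega>s" and len: "length \<sigma>s \<le> length \<omega>s"
    and sub: "set \<omega>s \<subseteq> cform.span (set \<sigma>s)" "set \<sigma>s \<subseteq> cform.span (set \<omega>s)"
  shows "basis10 J \<sigma>s"
proof -
  have span: "cform.span (set \<sigma>s) = cform.span (set \<omega>s)"
    using sub by (simp add: cform.span_eq)
  have "length \<omega>s = cform.dim (set \<omega>s)"
    using basis by (simp add: basis10_def cform.dim_eq_card_independent distinct_card)
  also have "\<dots> = cform.dim (set \<sigma>s)"
    using cform.span_eq_dim[OF span] by simp
  finally have dim: "length \<omega>s = cform.dim (set \<sigma>s)" .
  also have "\<dots> \<le> card (set \<sigma>s)"
    by (rule cform.dim_le_card) (auto simp: cform.span_superset)
  finally have "card (set \<sigma>s) = length \<sigma>s"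
    using len card_length[of \<sigma>s] by linarith
  then have "distinct \<sigma>s" and "card (set \<sigma>s) \<le> cform.dim (set \<sigma>s)"
    using len dim card_distinct by auto
  then show ?thesis
    using basis span cform.card_spanning_eq_dim_imp_independent[of "set \<sigma>s"]
    by (simp add: basis10_def)
qed

lemma sum_fun_apply: "(\<Sum>i\<in>A. f i) x = (\<Sum>i\<in>A. f i x)"
  by (induction A rule: infinite_finite_induct) auto

text \<open>The new closed forms are given by the inverse of \<open>P\<close>, so that the old ones are \<open>P\<close> times the new
ones; substituting this into the structure equation produces the congruent matrix.\<close>

lemma scaled_congruent_structure_equation:
  fixes \<omega> :: "3 \<Rightarrow> 'g::real_vector \<Rightarrow> complex"
  assumes basis: "basis10 J [\<omega> 1, \<omega> 2, \<omega> 3, \<omega>4]"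
    and closed: "\<forall>j. dCE br (\<omega> j) = 0"
    and d4: "dCE br \<omega>4 = (\<Sum>j\<in>UNIV. \<Sum>k\<in>UNIV. M $ j $ k *\<^sub>F wbar (\<omega> j) (\<omega> k))"
    and sim: "scaled_congruent M N"
  obtains \<sigma> :: "3 \<Rightarrow> 'g \<Rightarrow> complex" and \<sigma>4 where
    "basis10 J [\<sigma> 1, \<sigma> 2, \<sigma> 3, \<sigma>4]" "\<forall>j. dCE br (\<sigma> j) = 0"
    "dCE br \<sigma>4 = (\<Sum>j\<in>UNIV. \<Sum>k\<in>UNIV. N $ j $ k *\<^sub>F wbar (\<sigma> j) (\<sigma> k))"
proof -
  obtain c P where cP: "c \<noteq> 0" "invertible P" "N = map_matrix ((*) c) (congruence P M)"
    using sim unfolding scaled_congruent_def by auto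
  obtain Q where Q: "P ** Q = mat 1" "Q ** P = mat 1"
    using cP(2) unfolding invertible_def by auto
  define \<sigma> where "\<sigma> = (\<lambda>a. \<Sum>j\<in>UNIV. Q $ a $ j *\<^sub>F \<omega> j)"
  define \<sigma>4 where "\<sigma>4 = c *\<^sub>F \<omega>4"
  have \<sigma>: "\<sigma> a x = (\<Sum>j\<in>UNIV. Q $ a $ j * \<omega> j x)" for a x
    by (simp add: \<sigma>_def sum_fun_apply cscale_def)
  have \<omega>x: "\<omega> j x = (\<Sum>a\<in>UNIV. P $ j $ a * \<sigma> a x)" for j x
  proof -
    have "(\<Sum>a\<in>UNIV. P $ j $ a * \<sigma> a x) = (\<Sum>a\<in>UNIV. \<Sum>k\<in>UNIV. P $ j $ a * Q $ a $ k * \<omega> k x)"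
      by (simp add: \<sigma> sum_distrib_left mult.assoc)
    also have "\<dots> = (\<Sum>k\<in>UNIV. (P ** Q) $ j $ k * \<omega> k x)"
      by (subst sum.swap) (simp add: matrix_matrix_mult_def sum_distrib_right)
    also have "\<dots> = \<omega> j x"
      by (simp add: Q mat_def if_distrib[of "\<lambda>z. z * _"] cong: if_cong)
    finally show ?thesis ..
  qed
  have \<omega>: "\<omega> j = (\<Sum>a\<in>UNIV. P $ j $ a *\<^sub>F \<sigma> a)" for j
    by (rule ext) (simp add: sum_fun_apply cscale_def \<omega>x)
  have \<omega>4: "\<omega>4 = (1 / c) *\<^sub>F \<sigma>4"
    using cP(1) by (simp add: \<sigma>4_def cscale_def)
  have in\<sigma>: "\<sigma> a \<in> {\<sigma> 1, \<sigma> 2, \<sigma> 3, \<sigma>4}" and in\<omega>: "\<omega> a \<in> {\<omega> 1, \<omega> 2, \<omega> 3, \<omega>4}" for a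
    using exhaust_3[of a] by auto
  have "basis10 J [\<sigma> 1, \<sigma> 2, \<sigma> 3, \<sigma>4]"
  proof (rule basis10_change[OF basis])
    have "\<sigma> a \<in> cform.span {\<omega> 1, \<omega> 2, \<omega> 3, \<omega>4}" for a
      unfolding \<sigma>_def by (intro cform.span_sum cform.span_scale cform.span_base in\<omega>)
    moreover have "\<sigma>4 \<in> cform.span {\<omega> 1, \<omega> 2, \<omega> 3, \<omega>4}"
      unfolding \<sigma>4_def by (intro cform.span_scale cform.span_base) simp
    ultimately show "set [\<sigma> 1, \<sigma> 2, \<sigma> 3, \<sigma>4] \<subseteq> cform.span (set [\<omega> 1, \<omega> 2, \<omega> 3, \<omega>4])" by simp
    have "\<omega> a \<in> cform.span {\<sigma> 1, \<sigma> 2, \<sigma> 3, \<sigma>4}" for a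
      by (subst \<omega>) (intro cform.span_sum cform.span_scale cform.span_base in\<sigma>)
    moreover have "\<omega>4 \<in> cform.span {\<sigma> 1, \<sigma> 2, \<sigma> 3, \<sigma>4}"
      by (subst \<omega>4) (intro cform.span_scale cform.span_base, simp)
    ultimately show "set [\<omega> 1, \<omega> 2, \<omega> 3, \<omega>4] \<subseteq> cform.span (set [\<sigma> 1, \<sigma> 2, \<sigma> 3, \<sigma>4])" by simp
  qed simp
  moreover have "dCE br (\<sigma> a) = 0" for a
  proof -
    have "\<omega> j (br x y) = 0" for j x y
      using fun_cong[OF spec[OF closed, of j], of "(x, y)"] by (simp add: dCE_def)
    then show ?thesis by (auto simp: dCE_def \<sigma> fun_eq_iff)
  qed
  moreover have "dCE br \<sigma>4 = (\<Sum>j\<in>UNIV. \<Sum>k\<in>UNIV. N $ j $ k *\<^sub>F wbar (\<sigma> j) (\<sigma> k))"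
  proof (rule ext, clarify)
    fix x y
    have "dCE br \<sigma>4 (x, y) = c * dCE br \<omega>4 (x, y)"
      by (simp add: dCE_def \<sigma>4_def cscale_def)
    also have "\<dots> = c * (\<Sum>j\<in>UNIV. \<Sum>k\<in>UNIV. M $ j $ k * wbar (\<omega> j) (\<omega> k) (x, y))"
      unfolding d4 by (simp add: sum_fun_apply cscale_def)
    also have "\<dots> = (\<Sum>j\<in>UNIV. \<Sum>k\<in>UNIV. N $ j $ k * wbar (\<sigma> j) (\<sigma> k) (x, y))"
      unfolding cP(3) nth_map_matrix congruence_mat3 wbar_def wedge_def prod.case \<omega>x
      by (simp add: sum_3 algebra_simps)
    finally show "dCE br \<sigma>4 (x, y) =
        (\<Sum>j\<in>UNIV. \<Sum>k\<in>UNIV. N $ j $ k *\<^sub>F wbar (\<sigma> j) (\<sigma> k)) (x, y)"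
      by (simp add: sum_fun_apply cscale_def)
  qed
  ultimately show ?thesis using that by blast
qed

theorem theorem4p21:
  fixes br :: "'g::real_vector \<Rightarrow> 'g \<Rightarrow> 'g" and J :: "'g \<Rightarrow> 'g"
    and M :: "complex^3^3"
    and \<omega> :: "3 \<Rightarrow> 'g \<Rightarrow> complex" and \<omega>4 :: "'g \<Rightarrow> complex"
  assumes "lie_algebra br" and "dim (UNIV :: 'g set) = 8" and "nilpotent_lie br"
    and "one_abelian br J"
    and "basis10 J [\<omega> 1, \<omega> 2, \<omega> 3, \<omega>4]"
    and "\<forall>j. dCE br (\<omega> j) = 0"
    and "dCE br \<omega>4 = (\<Sum>j\<in>UNIV. \<Sum>k\<in>UNIV. M $ j $ k *\<^sub>F wbar (\<omega> j) (\<omega> k))"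
    and "invertible M"
    and "\<forall>c. c \<noteq> 0 \<longrightarrow> \<not> hermitian (map_matrix ((*) c) M)"
  shows "\<exists>\<sigma>1 \<sigma>2 \<sigma>3 \<sigma>4. basis10 J [\<sigma>1, \<sigma>2, \<sigma>3, \<sigma>4] \<and>
    dCE br \<sigma>1 = 0 \<and> dCE br \<sigma>2 = 0 \<and> dCE br \<sigma>3 = 0 \<and>
    (dCE br \<sigma>4 = wbar \<sigma>1 \<sigma>3 + wbar \<sigma>2 \<sigma>2 + wbar \<sigma>3 \<sigma>1
        + \<i> *\<^sub>F (wbar \<sigma>3 \<sigma>2 + wbar \<sigma>2 \<sigma>3)
     \<or> (dCE br \<sigma>4 = wbar \<sigma>1 \<sigma>2 + wbar \<sigma>2 \<sigma>1 + \<i> *\<^sub>F wbar \<sigma>2 \<sigma>2 + wbar \<sigma>3 \<sigma>3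
        \<or> dCE br \<sigma>4 = wbar \<sigma>1 \<sigma>2 + wbar \<sigma>2 \<sigma>1 + \<i> *\<^sub>F wbar \<sigma>2 \<sigma>2 - wbar \<sigma>3 \<sigma>3)
     \<or> (\<exists>z. cmod z = 1 \<and> z \<noteq> 1 \<and> z \<noteq> -1 \<and>
          dCE br \<sigma>4 = wbar \<sigma>1 \<sigma>2 + wbar \<sigma>2 \<sigma>1 + \<i> *\<^sub>F wbar \<sigma>2 \<sigma>2 + z *\<^sub>F wbar \<sigma>3 \<sigma>3)
     \<or> (\<exists>z. cmod z = 1 \<and> z \<noteq> 1 \<and> z \<noteq> -1 \<and>
          dCE br \<sigma>4 = wbar \<sigma>1 \<sigma>1 + wbar \<sigma>2 \<sigma>2 + z *\<^sub>F wbar \<sigma>3 \<sigma>3)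
     \<or> (\<exists>z \<theta>. cmod z = 1 \<and> z = exp (\<i> * complex_of_real \<theta>) \<and> 0 < \<theta> \<and> \<theta> < pi \<and>
          dCE br \<sigma>4 = wbar \<sigma>1 \<sigma>1 - wbar \<sigma>2 \<sigma>2 + z *\<^sub>F wbar \<sigma>3 \<sigma>3)
     \<or> (\<exists>z0. cmod z0 > 1 \<and>
          dCE br \<sigma>4 = wbar \<sigma>1 \<sigma>2 + z0 *\<^sub>F wbar \<sigma>2 \<sigma>1 + wbar \<sigma>3 \<sigma>3)
     \<or> (\<exists>z z1 \<theta>. cmod z = 1 \<and> z \<noteq> 1 \<and> z \<noteq> -1 \<and>
          cmod z1 = 1 \<and> z1 = exp (\<i> * complex_of_real \<theta>) \<and> 0 < \<theta> \<and> \<theta> < pi \<and>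
          z \<noteq> z1 \<and> z \<noteq> - z1 \<and>
          dCE br \<sigma>4 = wbar \<sigma>1 \<sigma>1 + z *\<^sub>F wbar \<sigma>2 \<sigma>2 + z1 *\<^sub>F wbar \<sigma>3 \<sigma>3))"
proof -
  obtain N where sim: "scaled_congruent M N" and N: "standard_form N \<or> hermitian N"
    using invertible_classified[OF assms(8)] unfolding classified_def by blast
  have "\<not> hermitian N"
    using hermitian_scaled_congruent[OF sim] assms(9) by blast
  then have std: "standard_form N" using N by blast
  obtain \<sigma> :: "3 \<Rightarrow> 'g \<Rightarrow> complex" and \<sigma>4 where basis: "basis10 J [\<sigma> 1, \<sigma> 2, \<sigma> 3, \<sigma>4]"
    and closed: "\<forall>j. dCE br (\<sigma> j) = 0"
    and d4: "dCE br \<sigma>4 = (\<Sum>j\<in>UNIV. \<Sum>k\<in>UNIV. N $ j $ k *\<^sub>F wbar (\<sigma> j) (\<sigma> k))"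
    using scaled_congruent_structure_equation[OF assms(5-7) sim] .
  note expand = sum_3 fun_eq_iff cscale_def algebra_simps
  show ?thesis
  proof (rule exI[of _ "\<sigma> 1"], rule exI[of _ "\<sigma> 2"], rule exI[of _ "\<sigma> 3"], rule exI[of _ \<sigma>4],
      intro conjI basis closed[rule_format], goal_cases)
    case 1
    show ?case
      using std
    proof cases
      case jordan3
      have "dCE br \<sigma>4 = wbar (\<sigma> 1) (\<sigma> 3) + wbar (\<sigma> 2) (\<sigma> 2) + wbar (\<sigma> 3) (\<sigma> 1)
          + \<i> *\<^sub>F (wbar (\<sigma> 3) (\<sigma> 2) + wbar (\<sigma> 2) (\<sigma> 3))"
        unfolding d4 jordan3 by (simp add: expand)
      then show ?thesis by blast
    next
      case (jordan2 z)
      have "dCE br \<sigma>4 = wbar (\<sigma> 1) (\<sigma> 2) + wbar (\<sigma> 2) (\<sigma> 1) + \<i> *\<^sub>F wbar (\<sigma> 2) (\<sigma> 2)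
          + z *\<^sub>F wbar (\<sigma> 3) (\<sigma> 3)"
        unfolding d4 jordan2(1) by (simp add: expand)
      moreover have "1 *\<^sub>F wbar (\<sigma> 3) (\<sigma> 3) = wbar (\<sigma> 3) (\<sigma> 3)" and
        "X + (-1) *\<^sub>F wbar (\<sigma> 3) (\<sigma> 3) = X - wbar (\<sigma> 3) (\<sigma> 3)" for X
        by (simp_all add: fun_eq_iff cscale_def)
      ultimately show ?thesis using jordan2(2) by (cases "z = 1"; cases "z = -1") auto
    next
      case (diag_plus z)
      have "dCE br \<sigma>4 = wbar (\<sigma> 1) (\<sigma> 1) + wbar (\<sigma> 2) (\<sigma> 2) + z *\<^sub>F wbar (\<sigma> 3) (\<sigma> 3)"
        unfolding d4 diag_plus(1) by (simp add: expand)
      moreover have "z \<noteq> 1" "z \<noteq> -1" using diag_plus(3) by auto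
      ultimately show ?thesis using diag_plus(2) by blast
    next
      case (diag_minus z)
      have "dCE br \<sigma>4 = wbar (\<sigma> 1) (\<sigma> 1) - wbar (\<sigma> 2) (\<sigma> 2) + z *\<^sub>F wbar (\<sigma> 3) (\<sigma> 3)"
        unfolding d4 diag_minus(1) by (simp add: expand)
      moreover obtain \<theta> where "z = exp (\<i> * complex_of_real \<theta>)" "0 < \<theta>" "\<theta> < pi"
        using unit_upper_half_plane_exp diag_minus(2,3) .
      ultimately show ?thesis using diag_minus(2) by blast
    next
      case (hyperbolic z)
      have "dCE br \<sigma>4 = wbar (\<sigma> 1) (\<sigma> 2) + z *\<^sub>F wbar (\<sigma> 2) (\<sigma> 1) + wbar (\<sigma> 3) (\<sigma> 3)"
        unfolding d4 hyperbolic(1) by (simp add: expand)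
      then show ?thesis using hyperbolic(2) by blast
    next
      case (diag_generic z w)
      have "dCE br \<sigma>4 = wbar (\<sigma> 1) (\<sigma> 1) + z *\<^sub>F wbar (\<sigma> 2) (\<sigma> 2) + w *\<^sub>F wbar (\<sigma> 3) (\<sigma> 3)"
        unfolding d4 diag_generic(1) by (simp add: expand)
      moreover have "z \<noteq> 1" "z \<noteq> -1" using diag_generic(3) by auto
      moreover obtain \<theta> where "w = exp (\<i> * complex_of_real \<theta>)" "0 < \<theta>" "\<theta> < pi"
        using unit_upper_half_plane_exp diag_generic(4,5) .
      ultimately show ?thesis using diag_generic(2,4,6,7) by blast
    qed
  qed
qed

end
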